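(* Let $R$ be a finite chain ring of length $2$ with residue field $\mathbb{F}_q$. Then there exists a projective $(q^4-q^2-q,\,q^2-1)$-arc in $\mathrm{PHG}(2,R)$; equivalently, $\mathrm{m}_{q^2-1}(R)\geq q(q+1)(q^2-1)-q^3=q^4-q^2-q$.
   Context: Throughout, $R$ is a finite chain ring of nilpotency index (length) $2$, i.e. a finite local ring with radical $\mathrm{rad}R\neq 0$, $(\mathrm{rad}R)^2=0$, whose one-sided ideals form the chain $R\supsetneq\mathrm{rad}R\supsetneq 0$, with residue field $R/\mathrm{rad}R\cong\mathbb{F}_q$ ($q$ a prime power); then $|R|=q^2$. The projective Hjelmslev plane $\mathrm{PHG}(2,R)$ is the incidence structure whose points are the free rank-$1$ submodules of the right module $R_R^3$, whose lines are the free rank-$2$ submodules of $R_R^3$, with incidence given by inclusion; it has $q^4+q^3+q^2$ points and each line contains $q^2+q$ points. A $(k,n)$-arc is a map $\mathcal{K}$ from the point set to $\mathbb{N}_0$ with $\sum_x\mathcal{K}(x)=k$ and $\sum_{x\in L}\mathcal{K}(x)\le n$ for every line $L$; it is projective if $\mathcal{K}$ takes only values in $\{0,1\}$ (i.e. it is a set of $k$ points meeting every line in at most $n$ points). For $0\le n\le q^2+q$, $\mathrm{m}_n(R)$ denotes the largest $k$ such that a projective $(k,n)$-arc exists in $\mathrm{PHG}(2,R)$. *)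

theory Defs
  imports Main
begin

definition right_ideal :: "'a::ring_1 set \<Rightarrow> bool" where
  "right_ideal I \<longleftrightarrow> 0 \<in> I \<and> (\<forall>x\<in>I. \<forall>y\<in>I. x + y \<in> I) \<and> (\<forall>x\<in>I. - x \<in> I)
     \<and> (\<forall>x\<in>I. \<forall>r. x * r \<in> I)"

definition left_ideal :: "'a::ring_1 set \<Rightarrow> bool" where
  "left_ideal I \<longleftrightarrow> 0 \<in> I \<and> (\<forall>x\<in>I. \<forall>y\<in>I. x + y \<in> I) \<and> (\<forall>x\<in>I. - x \<in> I)
     \<and> (\<forall>x\<in>I. \<forall>r. r * x \<in> I)"

definition maximal_right_ideal :: "'a::ring_1 set \<Rightarrow> bool" where
  "maximal_right_ideal I \<longleftrightarrow> right_ideal I \<and> I \<noteq> UNIV \<and>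
     (\<forall>J. right_ideal J \<and> I \<subseteq> J \<longrightarrow> J = I \<or> J = UNIV)"

definition rad :: "'a::ring_1 set" where
  "rad = \<Inter> {I. maximal_right_ideal I}"

definition chain_ring2 :: "'a::ring_1 itself \<Rightarrow> bool" where
  "chain_ring2 _ \<longleftrightarrow> finite (UNIV :: 'a set)
     \<and> (rad :: 'a set) \<noteq> {0} \<and> (rad :: 'a set) \<noteq> UNIV
     \<and> (\<forall>a\<in>(rad :: 'a set). \<forall>b\<in>rad. a * b = 0)
     \<and> {I :: 'a set. right_ideal I} = {UNIV, rad, {0}}
     \<and> {I :: 'a set. left_ideal I} = {UNIV, rad, {0}}"

definition residue_card :: "'a::ring_1 itself \<Rightarrow> nat" where
  "residue_card _ = card ((\<lambda>x::'a. {x + y | y. y \<in> rad}) ` UNIV)"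

type_synonym 'a vec3 = "'a \<times> 'a \<times> 'a"

definition vadd :: "'a::ring_1 vec3 \<Rightarrow> 'a vec3 \<Rightarrow> 'a vec3" where
  "vadd x y = (fst x + fst y, fst (snd x) + fst (snd y), snd (snd x) + snd (snd y))"

definition vsmult :: "'a::ring_1 vec3 \<Rightarrow> 'a \<Rightarrow> 'a vec3" where
  "vsmult x r = (fst x * r, fst (snd x) * r, snd (snd x) * r)"

text \<open>Free rank-1 submodules (points) and free rank-2 submodules (lines) of R_R^3:
  submodules having a basis of 1 resp. 2 elements.\<close>
definition hpoint :: "'a::ring_1 vec3 set \<Rightarrow> bool" where
  "hpoint M \<longleftrightarrow> (\<exists>x. M = {vsmult x r | r. True} \<and> inj (vsmult x))"

definition hline :: "'a::ring_1 vec3 set \<Rightarrow> bool" where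
  "hline M \<longleftrightarrow> (\<exists>x y. M = {vadd (vsmult x r) (vsmult y s) | r s. True}
      \<and> inj (\<lambda>(r, s). vadd (vsmult x r) (vsmult y s)))"

definition proj_arc :: "'a::ring_1 vec3 set set \<Rightarrow> nat \<Rightarrow> nat \<Rightarrow> bool" where
  "proj_arc K k n \<longleftrightarrow> (\<forall>P\<in>K. hpoint P) \<and> finite K \<and> card K = k
     \<and> (\<forall>L. hline L \<longrightarrow> card {P\<in>K. P \<subseteq> L} \<le> n)"

end

theory Submission
  imports Defs
begin

text \<open>
  The complement of the arc is a set of q(q+1)^2 points meeting every line at least q+1 times.
  In the projective plane PG(2,q) of neighbour classes let X be the class of (0,0,1), let z = 0 be a
  line not through X, and let U be the class of (0,1,0) on it. Every class other than X that is not
  on z = 0 receives a line segment pointing towards X, and the classes on z = 0 receive the points of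
  a line \<Lambda>. A line whose neighbour class is neither z = 0 nor a line through X then meets all
  these segments transversally, hence exactly q+1 times. The remaining lines are dealt with by
  taking all of X except q-1 collinear points, a second segment in U, and one additional point in
  each class on z = 0 other than U; the removed points of X pay for the additional ones.
\<close>

section \<open>Units, radical and cardinalities in a chain ring of length 2\<close>

locale length2_chain_ring =
  fixes R :: "'a::ring_1 itself"
  assumes chain: "chain_ring2 TYPE('a)"
begin

abbreviation J :: "'a set" where "J \<equiv> rad"

lemma fin [simp]: "finite (A :: 'a set)"
  using chain finite_subset[of A UNIV] unfolding chain_ring2_def by auto

lemma right_ideal_cases: "right_ideal (I :: 'a set) \<Longrightarrow> I = UNIV \<or> I = J \<or> I = {0}"
  using chain unfolding chain_ring2_def by blast

lemma right_ideal_rad: "right_ideal J" and left_ideal_rad: "left_ideal J"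
  using chain unfolding chain_ring2_def by blast+

lemma rad_neq: "J \<noteq> {0}" "J \<noteq> UNIV"
  using chain unfolding chain_ring2_def by blast+

lemma rad_0 [simp]: "0 \<in> J"
  and rad_add: "x \<in> J \<Longrightarrow> y \<in> J \<Longrightarrow> x + y \<in> J"
  and rad_uminus: "x \<in> J \<Longrightarrow> - x \<in> J"
  and rad_mult_right: "x \<in> J \<Longrightarrow> x * r \<in> J"
  using right_ideal_rad unfolding right_ideal_def by auto

lemma rad_mult_left: "x \<in> J \<Longrightarrow> r * x \<in> J"
  using left_ideal_rad unfolding left_ideal_def by auto

lemma rad_diff: "x \<in> J \<Longrightarrow> y \<in> J \<Longrightarrow> x - y \<in> J"
  using rad_add[of x "- y"] rad_uminus[of y] by simp

lemma rad_square [simp]: "x \<in> J \<Longrightarrow> y \<in> J \<Longrightarrow> x * y = 0"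
  using chain unfolding chain_ring2_def by blast

lemma one_notin_rad [simp]: "1 \<notin> J"
proof
  assume "1 \<in> J"
  then have "r \<in> J" for r using rad_mult_right[of 1 r] by simp
  then show False using rad_neq(2) by blast
qed

lemma principal_right_ideal: "right_ideal {x * r | r. True}" for x :: 'a
proof -
  have "\<exists>r. 0 = x * r" by (rule exI[of _ 0]) simp
  moreover have "\<exists>t. x * r + x * s = x * t" for r s
    by (rule exI[of _ "r + s"]) (simp add: distrib_left)
  moreover have "\<exists>t. - (x * r) = x * t" for r by (rule exI[of _ "- r"]) simp
  moreover have "\<exists>t. x * r * s = x * t" for r s by (rule exI[of _ "r * s"]) (simp add: mult.assoc)
  ultimately show ?thesis unfolding right_ideal_def by auto
qed

text \<open>The principal right ideal of \<open>x\<close> contains \<open>x\<close>, so it is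
  neither \<open>J\<close> nor \<open>{0}\<close> and must be the whole ring.\<close>

lemma right_inverse_exists:
  assumes "x \<notin> J" shows "\<exists>y. x * y = 1"
proof -
  have "x \<in> {x * r | r. True}" by (rule CollectI, rule exI[of _ 1]) simp
  moreover have "x \<noteq> 0" using assms by auto
  ultimately have "{x * r | r. True} = UNIV"
    using right_ideal_cases[OF principal_right_ideal[of x]] assms by auto
  then have "1 \<in> {x * r | r. True}" by simp
  then show ?thesis by auto
qed

text \<open>Meaningful only outside \<open>J\<close>, where the two-sided inverse exists and is
  unique.\<close>

definition uinv :: "'a \<Rightarrow> 'a" where "uinv x = (SOME y. x * y = 1 \<and> y * x = 1)"

text \<open>A right inverse \<open>y\<close> of \<open>x\<close> cannot lie in the left ideal
  \<open>J\<close>, so it has a right inverse in turn, and that one is \<open>x\<close> by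
  associativity.\<close>

lemma uinv:
  assumes "x \<notin> J"
  shows "x * uinv x = 1" "uinv x * x = 1" "uinv x \<notin> J"
proof -
  obtain y where y: "x * y = 1" using right_inverse_exists[OF assms] by blast
  have "y \<notin> J" using rad_mult_left[of y x] y by auto
  then obtain z where z: "y * z = 1" using right_inverse_exists by blast
  have "z = x * y * z" using y by simp
  also have "\<dots> = x" using z by (simp add: mult.assoc)
  finally have "y * x = 1" using z by simp
  with y have "x * uinv x = 1 \<and> uinv x * x = 1"
    unfolding uinv_def by (rule_tac someI[of _ y]) simp
  then show "x * uinv x = 1" "uinv x * x = 1" by auto
  then show "uinv x \<notin> J" using rad_mult_left[of "uinv x" x] by auto
qed

lemma uinv_cancel [simp]:
  assumes "x \<notin> J"
  shows "x * (uinv x * r) = r" "uinv x * (x * r) = r" "r * x * uinv x = r" "r * uinv x * x = r"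
  using uinv[OF assms] by (simp_all add: mult.assoc) (simp_all add: mult.assoc[symmetric])

lemma unit_mult: "x \<notin> J \<Longrightarrow> y \<notin> J \<Longrightarrow> x * y \<notin> J"
  using rad_mult_left[of "x * y" "uinv x"] by auto

lemma unit_cancel_right: "x \<notin> J \<Longrightarrow> r * x = s * x \<longleftrightarrow> r = s"
  by (metis uinv_cancel(3))

text \<open>The right annihilator of a nonzero radical element is exactly \<open>J\<close>: a unit
  can be cancelled, and \<open>J\<close> squares to zero.\<close>

lemma rad_mult_eq_0_iff: "c \<in> J \<Longrightarrow> c \<noteq> 0 \<Longrightarrow> c * r = 0 \<longleftrightarrow> r \<in> J"
  by (metis mult_zero_left rad_square uinv_cancel(3))

lemma rad_mult_onto:
  assumes "c \<in> J" "c \<noteq> 0" "j \<in> J" shows "\<exists>r. c * r = j"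
proof -
  have "c \<in> {c * r | r. True}" by (rule CollectI, rule exI[of _ 1]) simp
  moreover have "{c * r | r. True} \<subseteq> J" using rad_mult_right[OF assms(1)] by auto
  ultimately have "{c * r | r. True} = J"
    using right_ideal_cases[OF principal_right_ideal[of c]] assms rad_neq by auto
  then have "j \<in> {c * r | r. True}" using assms by simp
  then show ?thesis by auto
qed

text \<open>The fibre is a coset of the right annihilator of \<open>c\<close>, which is
  \<open>J\<close>.\<close>

lemma card_fibre:
  assumes "c \<in> J" "c \<noteq> 0" "j \<in> J" shows "card {r. c * r = j} = card J"
proof -
  obtain r0 where r0: "c * r0 = j" using rad_mult_onto[OF assms] by blast
  have "{r. c * r = j} = (+) r0 ` J"
  proof (intro equalityI subsetI)
    fix r assume "r \<in> {r. c * r = j}"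
    then have "c * (r - r0) = 0" using r0 by (simp add: right_diff_distrib)
    then have "r - r0 \<in> J" using rad_mult_eq_0_iff assms by blast
    then show "r \<in> (+) r0 ` J" by (rule rev_image_eqI) simp
  next
    fix r assume "r \<in> (+) r0 ` J"
    then show "r \<in> {r. c * r = j}" using r0 assms by (auto simp: distrib_left)
  qed
  then show ?thesis by (simp add: card_image)
qed

text \<open>Left multiplication by a nonzero \<open>c\<close> in \<open>J\<close> maps the ring onto
  \<open>J\<close> with all fibres of size \<open>card J\<close>.\<close>

lemma card_UNIV_eq: "card (UNIV :: 'a set) = card J * card J"
proof -
  obtain c where c: "c \<in> J" "c \<noteq> 0" using rad_neq rad_0 by blast
  have "(UNIV :: 'a set) = (\<Union>j\<in>J. {r. c * r = j})" using rad_mult_right[OF c(1)] by auto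
  also have "card \<dots> = (\<Sum>j\<in>J. card {r. c * r = j})"
    by (rule card_UN_disjoint) auto
  also have "\<dots> = card J * card J" using card_fibre[OF c] by simp
  finally show ?thesis .
qed

lemma card_compl: "card (- A :: 'a set) + card A = card J * card J"
  using card_Un_disjoint[of "- A" A] card_UNIV_eq by (simp add: Compl_partition2)

lemma card_rad_ge_2: "card J \<ge> 2"
proof -
  obtain c where c: "c \<in> J" "c \<noteq> 0" using rad_neq rad_0 by blast
  then have "card {0, c} \<le> card J" by (intro card_mono) auto
  then show ?thesis using c by simp
qed

lemma transversal_exists:
  obtains T where "\<And>x. \<exists>t\<in>T. x - t \<in> J" "\<And>s t. s \<in> T \<Longrightarrow> t \<in> T \<Longrightarrow> s - t \<in> J \<Longrightarrow> s = t"
    "card T = residue_card TYPE('a)"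
proof -
  define cs where "cs x = {x + y | y. y \<in> J}" for x :: 'a
  have mem: "y \<in> cs x \<longleftrightarrow> y - x \<in> J" for x y
    unfolding cs_def by (auto intro: exI[of _ "y - x"])
  have eq: "cs x = cs y \<longleftrightarrow> x - y \<in> J" for x y
  proof
    assume "cs x = cs y"
    then show "x - y \<in> J" using mem[of x x] mem[of x y] by simp
  next
    assume a: "x - y \<in> J"
    have "z - y \<in> J \<longleftrightarrow> z - x \<in> J" for z
      using rad_add[OF _ a, of "z - x"] rad_diff[OF _ a, of "z - y"] by auto
    then show "cs x = cs y" using mem by blast
  qed
  \<comment> \<open>One representative is chosen from each coset of the radical.\<close>
  define T where "T = inv cs ` range cs"
  have cs_inv: "cs (inv cs C) = C" if "C \<in> range cs" for C using that by (rule f_inv_into_f)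
  show ?thesis
  proof (rule that[of T])
    show "\<exists>t\<in>T. x - t \<in> J" for x
      using eq[of x "inv cs (cs x)"] cs_inv[of "cs x"] unfolding T_def by auto
    show "s = t" if "s \<in> T" "t \<in> T" "s - t \<in> J" for s t
      using that eq[of s t] cs_inv unfolding T_def by auto
    have "inj_on (inv cs) (range cs)" by (rule inj_on_inv_into) simp
    then have "card T = card (range cs)" unfolding T_def by (rule card_image)
    then show "card T = residue_card TYPE('a)" unfolding residue_card_def cs_def .
  qed
qed

text \<open>Every ring element is uniquely \<open>t + j\<close> with \<open>t\<close> in
  \<open>T\<close> and \<open>j\<close> in \<open>J\<close>; one factor \<open>card J\<close> then
  cancels. This identifies the size of the radical with that of the residue field.\<close>

lemma card_transversal:
  assumes T: "\<And>x. \<exists>t\<in>T. x - t \<in> J" "\<And>s t. s \<in> T \<Longrightarrow> t \<in> T \<Longrightarrow> s - t \<in> J \<Longrightarrow> s = t"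
  shows "card T = card J"
proof -
  have "(\<lambda>(t, j). t + j) ` (T \<times> J) = UNIV"
  proof (intro equalityI subsetI)
    fix x :: 'a
    obtain t where t: "t \<in> T" "x - t \<in> J" using T(1) by blast
    then show "x \<in> (\<lambda>(t, j). t + j) ` (T \<times> J)"
      by (intro image_eqI[of _ _ "(t, x - t)"]) auto
  qed simp
  moreover have "inj_on (\<lambda>(t, j). t + j) (T \<times> J)"
  proof (rule inj_onI, clarify)
    fix s i t j assume a: "s \<in> T" "i \<in> J" "t \<in> T" "j \<in> J" "s + i = t + j"
    then have "s - t = j - i" by (simp add: algebra_simps)
    then have "s - t \<in> J" using rad_diff a by simp
    then have "s = t" using T(2) a by blast
    then show "s = t \<and> i = j" using a by simp
  qed
  ultimately have "card (UNIV :: 'a set) = card (T \<times> J)" using card_image by metis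
  then show ?thesis using card_UNIV_eq card_rad_ge_2 by (auto simp: card_cartesian_product)
qed

section \<open>Linear equations of lines\<close>

lemma unit_entry:
  assumes "\<And>r. a * r = 0 \<Longrightarrow> b * r = 0 \<Longrightarrow> c * r = 0 \<Longrightarrow> r = 0"
  shows "a \<notin> J \<or> b \<notin> J \<or> c \<notin> J"
proof (rule ccontr)
  assume "\<not> ?thesis"
  \<comment> \<open>A nonzero radical element is annihilated from the left by all of
    \<open>J\<close>, so it would be a nontrivial common solution.\<close>
  moreover obtain d where "d \<in> J" "d \<noteq> 0" using rad_neq rad_0 by blast
  ultimately show False using assms[of d] by auto
qed

text \<open>Column elimination: subtracting \<open>k\<close> times the first generator from the
  second clears the first entry of the latter. By independence one of the two remaining entries is a
  unit, and the other coordinate can be expressed through it and the first one.\<close>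

lemma eliminate_coordinate:
  assumes x1: "x1 \<notin> J"
    and indep: "\<And>r s. x1 * r + y1 * s = 0 \<Longrightarrow> x2 * r + y2 * s = 0 \<Longrightarrow> x3 * r + y3 * s = 0 \<Longrightarrow> s = 0"
  shows "(\<exists>\<alpha> \<beta>. x3 = \<alpha> * x1 + \<beta> * x2 \<and> y3 = \<alpha> * y1 + \<beta> * y2) \<or>
         (\<exists>\<alpha> \<beta>. x2 = \<alpha> * x1 + \<beta> * x3 \<and> y2 = \<alpha> * y1 + \<beta> * y3)"
proof -
  define k where "k = uinv x1 * y1"
  have y1: "y1 = x1 * k" unfolding k_def using x1 by simp
  have "0 \<notin> J \<or> y2 - x2 * k \<notin> J \<or> y3 - x3 * k \<notin> J"
  proof (rule unit_entry)
    fix r assume "(y2 - x2 * k) * r = 0" "(y3 - x3 * k) * r = 0"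
    then show "r = 0" using indep[of "- (k * r)" r] y1 by (simp add: algebra_simps)
  qed
  moreover have "\<exists>\<alpha> \<beta>. c = \<alpha> * x1 + \<beta> * b \<and> c' = \<alpha> * y1 + \<beta> * b'"
    if u: "b' - b * k \<notin> J" for b b' c c'
  proof -
    \<comment> \<open>The eliminated column determines \<beta>; the first coordinate of the
      generators then determines \<alpha>.\<close>
    define \<beta> where "\<beta> = (c' - c * k) * uinv (b' - b * k)"
    define \<alpha> where "\<alpha> = (c - \<beta> * b) * uinv x1"
    have 1: "\<alpha> * x1 = c - \<beta> * b" unfolding \<alpha>_def using x1 by simp
    have 2: "\<beta> * (b' - b * k) = c' - c * k" unfolding \<beta>_def using u by simp
    have "\<alpha> * y1 + \<beta> * b' = \<alpha> * x1 * k + \<beta> * b'" using y1 by (simp add: mult.assoc)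
    also have "\<dots> = c * k + \<beta> * (b' - b * k)" unfolding 1 by (simp add: algebra_simps)
    finally have "c' = \<alpha> * y1 + \<beta> * b'" unfolding 2 by simp
    then show ?thesis using 1 by (intro exI[of _ \<alpha>] exI[of _ \<beta>]) simp
  qed
  ultimately show ?thesis by auto
qed

text \<open>Two independent generators satisfy a linear equation with a coefficient 1. It is solved
  for \<open>y\<close> if the coefficient of \<open>y\<close> is a unit, otherwise for
  \<open>x\<close> if that of \<open>x\<close> is a unit, otherwise for \<open>z\<close>; this order
  puts the remaining coefficients into \<open>J\<close> where stated. Inclusion suffices for
  bounding intersections from above.\<close>

lemma hline_equation:
  assumes "hline (L :: 'a vec3 set)"
  obtains t c where "L \<subseteq> {(x, y, z). y = t * x + c * z}"
  | s c where "s \<in> J" "L \<subseteq> {(x, y, z). x = s * y + c * z}"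
  | \<alpha> \<beta> where "\<alpha> \<in> J" "\<beta> \<in> J" "L \<subseteq> {(x, y, z). z = \<alpha> * x + \<beta> * y}"
proof -
  obtain v w where L: "L = {vadd (vsmult v r) (vsmult w s) | r s. True}"
    and inj: "inj (\<lambda>(r, s). vadd (vsmult v r) (vsmult w s))"
    using assms unfolding hline_def by blast
  obtain x1 x2 x3 where v: "v = (x1, x2, x3)" by (cases v)
  obtain y1 y2 y3 where w: "w = (y1, y2, y3)" by (cases w)
  have indep: "r = 0 \<and> s = 0"
    if "x1 * r + y1 * s = 0" "x2 * r + y2 * s = 0" "x3 * r + y3 * s = 0" for r s
    using injD[OF inj, of "(r, s)" "(0, 0)"] that by (simp add: v w vadd_def vsmult_def)
  have lin: "\<alpha> * (a * r + a' * s) + \<beta> * (b * r + b' * s) = (\<alpha> * a + \<beta> * b) * r + (\<alpha> * a' + \<beta> * b') * s"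
    for \<alpha> \<beta> a a' b b' r s :: 'a by (simp add: algebra_simps)
  have sub1: "L \<subseteq> {(x, y, z). x = \<alpha> * y + \<beta> * z}"
    if "x1 = \<alpha> * x2 + \<beta> * x3" "y1 = \<alpha> * y2 + \<beta> * y3" for \<alpha> \<beta>
    unfolding L using that by (auto simp: v w vadd_def vsmult_def lin)
  have sub2: "L \<subseteq> {(x, y, z). y = \<alpha> * x + \<beta> * z}"
    if "x2 = \<alpha> * x1 + \<beta> * x3" "y2 = \<alpha> * y1 + \<beta> * y3" for \<alpha> \<beta>
    unfolding L using that by (auto simp: v w vadd_def vsmult_def lin)
  have sub3: "L \<subseteq> {(x, y, z). z = \<alpha> * x + \<beta> * y}"
    if "x3 = \<alpha> * x1 + \<beta> * x2" "y3 = \<alpha> * y1 + \<beta> * y2" for \<alpha> \<beta>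
    unfolding L using that by (auto simp: v w vadd_def vsmult_def lin)
  have "x1 \<notin> J \<or> x2 \<notin> J \<or> x3 \<notin> J" by (rule unit_entry) (use indep[of _ 0] in auto)
  then have "(\<exists>\<alpha> \<beta>. L \<subseteq> {(x, y, z). x = \<alpha> * y + \<beta> * z}) \<or>
    (\<exists>\<alpha> \<beta>. L \<subseteq> {(x, y, z). y = \<alpha> * x + \<beta> * z}) \<or>
    (\<exists>\<alpha> \<beta>. L \<subseteq> {(x, y, z). z = \<alpha> * x + \<beta> * y})"
  proof (elim disjE)
    assume "x1 \<notin> J"
    then have "(\<exists>\<alpha> \<beta>. x3 = \<alpha> * x1 + \<beta> * x2 \<and> y3 = \<alpha> * y1 + \<beta> * y2) \<or>
        (\<exists>\<alpha> \<beta>. x2 = \<alpha> * x1 + \<beta> * x3 \<and> y2 = \<alpha> * y1 + \<beta> * y3)"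
      by (rule eliminate_coordinate) (use indep in blast)
    then show ?thesis using sub2 sub3 by blast
  next
    assume "x2 \<notin> J"
    then have "(\<exists>\<alpha> \<beta>. x3 = \<alpha> * x2 + \<beta> * x1 \<and> y3 = \<alpha> * y2 + \<beta> * y1) \<or>
        (\<exists>\<alpha> \<beta>. x1 = \<alpha> * x2 + \<beta> * x3 \<and> y1 = \<alpha> * y2 + \<beta> * y3)"
      by (rule eliminate_coordinate) (use indep in blast)
    then show ?thesis using sub1 sub3 add.commute by metis
  next
    assume "x3 \<notin> J"
    then have "(\<exists>\<alpha> \<beta>. x2 = \<alpha> * x3 + \<beta> * x1 \<and> y2 = \<alpha> * y3 + \<beta> * y1) \<or>
        (\<exists>\<alpha> \<beta>. x1 = \<alpha> * x3 + \<beta> * x2 \<and> y1 = \<alpha> * y3 + \<beta> * y2)"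
      by (rule eliminate_coordinate) (use indep in blast)
    then show ?thesis using sub1 sub2 add.commute by metis
  qed
  then show ?thesis
  proof (elim disjE exE)
    fix \<alpha> \<beta> assume l: "L \<subseteq> {(x, y, z). x = \<alpha> * y + \<beta> * z}"
    show ?thesis
    proof (cases "\<alpha> \<in> J")
      case True then show ?thesis using l that(2) by blast
    next
      case False
      have "L \<subseteq> {(x, y, z). y = uinv \<alpha> * x + (- (uinv \<alpha> * \<beta>)) * z}"
        using l False by (auto simp: distrib_left mult.assoc)
      then show ?thesis by (rule that(1))
    qed
  next
    fix \<alpha> \<beta> assume "L \<subseteq> {(x, y, z). y = \<alpha> * x + \<beta> * z}"
    then show ?thesis by (rule that(1))
  next
    fix \<alpha> \<beta> assume l: "L \<subseteq> {(x, y, z). z = \<alpha> * x + \<beta> * y}"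
    show ?thesis
    proof (cases "\<beta> \<in> J")
      case False
      have "L \<subseteq> {(x, y, z). y = (- (uinv \<beta> * \<alpha>)) * x + uinv \<beta> * z}"
        using l False by (auto simp: distrib_left mult.assoc)
      then show ?thesis by (rule that(1))
    next
      case b: True
      show ?thesis
      proof (cases "\<alpha> \<in> J")
        case True then show ?thesis using l b that(3) by blast
      next
        case False
        have "L \<subseteq> {(x, y, z). x = (- (uinv \<alpha> * \<beta>)) * y + uinv \<alpha> * z}"
          using l False by (auto simp: distrib_left mult.assoc)
        then show ?thesis using that(2) rad_uminus[OF rad_mult_left[OF b]] by blast
      qed
    qed
  qed
qed

end

section \<open>Parameters and generators of the arc\<close>

locale arc_construction = length2_chain_ring R for R :: "'a::ring_1 itself" +
  fixes q :: nat and T :: "'a set" and \<phi> :: "'a \<Rightarrow> 'a" and \<theta> :: 'a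
  assumes card_rad [simp]: "card (rad :: 'a set) = q"
    and T_ex: "\<exists>t\<in>T. x - t \<in> rad"
    and T_uniq: "s \<in> T \<Longrightarrow> t \<in> T \<Longrightarrow> s - t \<in> rad \<Longrightarrow> s = t"
    and \<phi>_onto: "\<phi> ` T = rad - {0}"
    and \<theta>: "\<theta> \<in> rad" "\<theta> \<noteq> 0"
begin

lemmas q_ge_2 = card_rad_ge_2[unfolded card_rad]
lemmas card_compl_q = card_compl[unfolded card_rad]
lemmas card_fibre_q = card_fibre[unfolded card_rad]

lemma card_T: "card T = q"
  using card_transversal[of T, OF T_ex T_uniq] by simp

text \<open>
  A point is represented by its generator (x, y, 1), (1, s, j) or (j, 1, k) with j, k in the radical.
  The removed segments outside z = 0 lie on the lines y = t x through the origin (t in the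
  transversal) and on the line x = \<theta> z, whose part in U is the second segment there;
  \<Lambda> is z = 0. The additional points are (1, t, \<phi> t): surjectivity of \<phi>
  makes them meet every line z = \<alpha> x with \<alpha> a nonzero element of the radical, the only
  neighbours of \<Lambda> sharing with it its segment in U.
\<close>

definition affine_part :: "('a \<times> 'a) set" where
  "affine_part = {(x, y). x \<notin> J \<and> (\<forall>t\<in>T. y \<noteq> t * x)}
     \<union> {(x, y). x \<in> J - {\<theta>} \<and> y \<notin> J} \<union> {(x, y). x = 0 \<and> y \<in> J - {0}}"

definition infinite_part :: "('a \<times> 'a) set" where
  "infinite_part = {(s, j). j \<in> J - {0} \<and> \<not> (s \<in> T \<and> j = \<phi> s)}"

definition arc_vectors :: "'a vec3 set" where
  "arc_vectors = (\<lambda>(x, y). (x, y, 1)) ` affine_part \<union> (\<lambda>(s, j). (1, s, j)) ` infinite_part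
     \<union> (\<lambda>(j, k). (j, 1, k)) ` ((J - {0}) \<times> (J - {0}))"

section \<open>Cardinality of the arc\<close>

lemma finite_pairs [simp]: "finite (A :: ('a \<times> 'a) set)"
  by (rule finite_subset[OF subset_UNIV]) (simp add: finite_prod)

lemma finite_vectors [simp]: "finite (A :: 'a vec3 set)"
  by (rule finite_subset[OF subset_UNIV]) (simp add: finite_prod)

lemma card_rad_minus: "j \<in> J \<Longrightarrow> card (J - {j}) + 1 = q"
  using q_ge_2 by simp

text \<open>Over each unit \<open>x\<close> the \<open>q\<close> values \<open>t * x\<close> are
  distinct, so every such fibre keeps \<open>q * q - q\<close> elements. Terms are moved across the
  equation to limit truncated subtraction.\<close>

lemma card_affine_part: "card affine_part + q * q + 1 = (q * q - q) * (q * q) + 2 * q"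
proof -
  define u where "u = card (- J)"
  have u: "u + q = q * q" unfolding u_def using card_compl_q[of J] by simp
  let ?A1 = "SIGMA x:- J. - (\<lambda>t. t * x) ` T"
  let ?A2 = "(J - {\<theta>}) \<times> (- J)"
  let ?A3 = "{0} \<times> (J - {0})"
  have fibre: "card (- (\<lambda>t. t * x) ` T) = u" if "x \<in> - J" for x
  proof -
    have "card ((\<lambda>t. t * x) ` T) = q"
      using that card_T unit_cancel_right[of x] by (subst card_image) (auto simp: inj_on_def)
    then show ?thesis using card_compl_q[of "(\<lambda>t. t * x) ` T"] u by simp
  qed
  have "affine_part = ?A1 \<union> ?A2 \<union> ?A3" unfolding affine_part_def by auto
  moreover have "card (?A1 \<union> ?A2 \<union> ?A3) = card ?A1 + card ?A2 + card ?A3"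
    by (subst card_Un_disjoint, simp, simp, force, subst card_Un_disjoint) auto
  moreover have "card ?A1 = u * u" using fibre by (simp add: card_SigmaI u_def)
  moreover have "card ?A2 = (q - 1) * u" using \<theta> by (simp add: card_cartesian_product u_def)
  moreover have "card ?A3 = q - 1" by (simp add: card_cartesian_product)
  ultimately have eq: "card affine_part = u * u + (q - 1) * u + (q - 1)" by simp
  obtain p where p: "q = Suc p" using q_ge_2 by (cases q) auto
  have "q * q - q = u" using u by simp
  moreover have "u = p * Suc p" using u p by simp
  ultimately show ?thesis using eq unfolding p by (simp add: algebra_simps)
qed

lemma card_infinite_part: "card infinite_part + q = q * q * (q - 1)"
proof -
  let ?G = "(\<lambda>s. (s, \<phi> s)) ` T"
  have "card ?G = q" using card_T by (subst card_image) (auto simp: inj_on_def)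
  moreover have sub: "?G \<subseteq> UNIV \<times> (J - {0})" using \<phi>_onto by auto
  moreover have "infinite_part = UNIV \<times> (J - {0}) - ?G" unfolding infinite_part_def by auto
  moreover have "card ((UNIV :: 'a set) \<times> (J - {0})) = q * q * (q - 1)"
    using card_UNIV_eq by (simp add: card_cartesian_product)
  moreover have "card ?G \<le> card ((UNIV :: 'a set) \<times> (J - {0}))" by (rule card_mono[OF _ sub]) simp
  ultimately show ?thesis by (simp add: card_Diff_subset)
qed

text \<open>This is \<open>q^4 + q^3 + q^2\<close>, the number of all points, less the
  \<open>q * (q + 1)^2\<close> points of the complement.\<close>

lemma card_arc_vectors: "card arc_vectors + q ^ 2 + q = q ^ 4"
proof -
  let ?A = "(\<lambda>(x, y). (x, y, 1 :: 'a)) ` affine_part"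
  let ?B = "(\<lambda>(s, j). (1 :: 'a, s, j)) ` infinite_part"
  let ?C = "(\<lambda>(j, k). (j, 1 :: 'a, k)) ` ((J - {0}) \<times> (J - {0}))"
  have "?A \<inter> ?B = {}" "(?A \<union> ?B) \<inter> ?C = {}" unfolding infinite_part_def by auto
  then have "card arc_vectors = card ?A + card ?B + card ?C"
    unfolding arc_vectors_def by (simp add: card_Un_disjoint)
  moreover have "card ?A = card affine_part" by (rule card_image) (auto simp: inj_on_def)
  moreover have "card ?B = card infinite_part" by (rule card_image) (auto simp: inj_on_def)
  moreover have "card ?C = (q - 1) * (q - 1)"
    by (subst card_image) (auto simp: inj_on_def card_cartesian_product)
  \<comment> \<open>Writing \<open>q\<close> as a successor turns the truncated differences into
    polynomials in \<open>p\<close>.\<close>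
  moreover obtain p where p: "q = Suc p" using q_ge_2 by (cases q) auto
  ultimately show ?thesis using card_affine_part card_infinite_part
    unfolding p by (simp add: algebra_simps power2_eq_square power4_eq_xxxx)
qed

section \<open>Intersections with lines\<close>

lemma card_subset_diff:
  assumes "A \<subseteq> B - C" "C \<subseteq> B"
  shows "card (A :: 'a set) + card C \<le> card B"
proof -
  have "card A + card C = card (A \<union> C)" using assms by (intro card_Un_disjoint[symmetric]) auto
  also have "\<dots> \<le> card B" using assms by (intro card_mono) auto
  finally show ?thesis .
qed

text \<open>On a line of each of the three kinds only two of the three shapes of arc vectors occur,
  and each such vector is determined by one ring element. Line counts thus become counts of
  parameters.\<close>

lemma card_two_images:
  assumes "S \<subseteq> f ` X \<union> g ` Y"
  shows "card (S :: 'a vec3 set) \<le> card (X :: 'a set) + card (Y :: 'a set)"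
proof -
  have "card S \<le> card (f ` X \<union> g ` Y)" using assms by (intro card_mono) auto
  also have "\<dots> \<le> card (f ` X) + card (g ` Y)" by (rule card_Un_le)
  also have "\<dots> \<le> card X + card Y" by (intro add_mono card_image_le) auto
  finally show ?thesis .
qed

text \<open>\<open>X\<close> counts the vectors with last entry 1, \<open>Y\<close> those in classes
  on z = 0. As \<open>Y\<close> has at most \<open>q - 1\<close> elements, at most
  \<open>q * q - q\<close> elements in \<open>X\<close> are enough; where \<open>X\<close> may have
  one more, \<open>Y\<close> has one less. The class of the line passes through that of (0,0,1)
  exactly if \<open>c\<close> is in \<open>J\<close>.\<close>

lemma count_line_first:
  "card (arc_vectors \<inter> {(x, y, z). y = t * x + c * z}) + 1 \<le> q * q"
proof -
  define X where "X = {x. (x, t * x + c) \<in> affine_part}"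
  define Y where "Y = {j. (t + c * j, j) \<in> infinite_part}"
  have "arc_vectors \<inter> {(x, y, z). y = t * x + c * z}
      \<subseteq> (\<lambda>x. (x, t * x + c, 1)) ` X \<union> (\<lambda>j. (1, t + c * j, j)) ` Y"
  proof -
    have "1 \<noteq> t * j + c * k" if "j \<in> J" "k \<in> J" for j k
      using that rad_add[OF rad_mult_left rad_mult_left] one_notin_rad by metis
    then show ?thesis unfolding arc_vectors_def X_def Y_def by auto
  qed
  then have bound: "card (arc_vectors \<inter> {(x, y, z). y = t * x + c * z}) \<le> card X + card Y"
    by (rule card_two_images)
  have Y: "Y \<subseteq> J - {0}" unfolding Y_def infinite_part_def by auto
  have cardY: "card Y + 1 \<le> q"
    using card_mono[OF _ Y] card_rad_minus[of 0] by simp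
  have u: "card (- J) + q = q * q" using card_compl_q[of J] by simp
  \<comment> \<open>\<tau> represents the class of \<open>t\<close>; every other element of
    \<open>T\<close> differs from \<open>t\<close> by a unit.\<close>
  obtain \<tau> where \<tau>: "\<tau> \<in> T" "\<tau> - t \<in> J" using T_ex[of t] rad_uminus[of "t - _"] by force
  show ?thesis
  proof (cases "c \<in> J")
    case False
    \<comment> \<open>These are the units \<open>x\<close> at which the line meets the removed lines
      y = t' x with t' other than \<tau>; the \<open>q - 1\<close> values lost here balance
      \<open>J - {\<theta>}\<close>.\<close>
    define Z where "Z = (\<lambda>t'. uinv (t' - t) * c) ` (T - {\<tau>})"
    have unit: "t' - t \<notin> J" if "t' \<in> T - {\<tau>}" for t'
      using that \<tau> T_uniq[of t' \<tau>] rad_diff[of "t' - t" "\<tau> - t"] by auto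
    have sol: "(t' - t) * (uinv (t' - t) * c) = c" if "t' \<in> T - {\<tau>}" for t'
      using unit[OF that] by simp
    have Zu: "Z \<subseteq> - J" unfolding Z_def using unit unit_mult uinv(3) False by blast
    have "inj_on (\<lambda>t'. uinv (t' - t) * c) (T - {\<tau>})"
    proof (rule inj_onI)
      fix a b assume ab: "a \<in> T - {\<tau>}" "b \<in> T - {\<tau>}" "uinv (a - t) * c = uinv (b - t) * c"
      have "uinv (a - t) * c \<notin> J" using unit ab unit_mult uinv(3) False by blast
      then have "a - t = b - t" using sol[OF ab(1)] sol[OF ab(2)] ab(3) unit_cancel_right by metis
      then show "a = b" by simp
    qed
    then have cZ: "card Z + 1 = q" unfolding Z_def using card_T \<tau> q_ge_2 by (simp add: card_image)
    define X1 where "X1 = {x. x \<notin> J \<and> (\<forall>t'\<in>T. t * x + c \<noteq> t' * x)}"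
    have "x \<notin> Z" if "x \<in> X1" for x
    proof
      assume "x \<in> Z"
      then obtain t' where t': "t' \<in> T - {\<tau>}" "x = uinv (t' - t) * c" unfolding Z_def by blast
      then have "t * x + c = t' * x" using sol[OF t'(1)] by (simp add: left_diff_distrib algebra_simps)
      then show False using that t' unfolding X1_def by auto
    qed
    then have "X1 \<subseteq> - J - Z" unfolding X1_def by auto
    then have "card X1 + card Z \<le> card (- J)" using Zu by (rule card_subset_diff)
    moreover have "X \<subseteq> X1 \<union> (J - {\<theta>})" unfolding X_def X1_def affine_part_def using False by auto
    then have "card X \<le> card (X1 \<union> (J - {\<theta>}))" by (intro card_mono) auto
    then have "card X \<le> card X1 + card (J - {\<theta>})" using card_Un_le order_trans by blast
    ultimately show ?thesis using bound cardY cZ card_rad_minus[OF \<theta>(1)] u by linarith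
  next
    case c: True
    have X2: "t * x + c \<in> J" if "x \<in> J" for x using that c rad_add rad_mult_left by blast
    show ?thesis
    proof (cases "c = 0")
      case c0: True
      show ?thesis
      proof (cases "t \<in> T")
        case True
        \<comment> \<open>The line is itself one of the removed lines; over \<open>x\<close> in
          \<open>J\<close> only the pair (0, 0) could occur, and it is not in
          \<open>affine_part\<close>.\<close>
        then have "X = {}" unfolding X_def affine_part_def using c0 X2 by auto
        then show ?thesis using bound cardY u by simp
      next
        case False
        have "X \<subseteq> - J" unfolding X_def affine_part_def using c0 X2 by auto
        then have "card X \<le> card (- J)" by (intro card_mono) auto
        then show ?thesis using bound cardY u by linarith
      qed
    next
      case c0: False
      show ?thesis
      proof (cases "t \<in> T")
        case True
        have "X \<subseteq> - J \<union> {0}" unfolding X_def affine_part_def using X2 by auto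
        then have "card X \<le> card (- J \<union> {0})" by (intro card_mono) auto
        then have "card X \<le> card (- J) + 1" using card_Un_le[of "- J" "{0}"] by simp
        \<comment> \<open>The kept point (0, c, 1) may raise \<open>X\<close> by one. The additional
          point (1, t, \<phi> t) of the complement lies on the line because
          \<open>c * \<phi> t = 0\<close>, and it compensates.\<close>
        moreover have "Y \<subseteq> (J - {0}) - {\<phi> t}"
          unfolding Y_def infinite_part_def using True c by auto
        moreover have "\<phi> t \<in> J - {0}" using True \<phi>_onto by blast
        ultimately show ?thesis
          using bound u card_subset_diff[of Y "J - {0}" "{\<phi> t}"] card_rad_minus[of 0] by simp
      next
        case False
        \<comment> \<open>Meeting the removed line y = \<tau> x means \<open>d * x = c\<close>,
          which has \<open>q\<close> solutions, all units since \<open>c\<close> is nonzero: the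
          line contains a whole removed segment.\<close>
        define d where "d = \<tau> - t"
        have d: "d \<in> J" "d \<noteq> 0" using \<tau> False unfolding d_def by auto
        define Z where "Z = {x. d * x = c}"
        have "card Z = q" unfolding Z_def using card_fibre_q d c by blast
        moreover have "Z \<subseteq> - J" unfolding Z_def using d c0 by auto
        moreover have "X - {0} \<subseteq> - J - Z"
          unfolding X_def affine_part_def Z_def d_def using X2 \<tau>(1) by (auto simp: left_diff_distrib)
        ultimately have "card (X - {0}) + q \<le> card (- J)" using card_subset_diff by metis
        moreover have "card X - 1 \<le> card (X - {0})" by (simp add: card_Diff_singleton_if)
        ultimately show ?thesis using bound cardY u q_ge_2 by linarith
      qed
    qed
  qed
qed

text \<open>If \<open>c\<close> is a unit, the removed lines y = t x account for \<open>q\<close>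
  missing values of \<open>y\<close>. If \<open>c\<close> is in \<open>J\<close>, the line has class
  x = 0, and the removed line x = \<theta> z together with the structure of the two classes X and U
  decides.\<close>

lemma count_line_second:
  assumes s: "s \<in> J"
  shows "card (arc_vectors \<inter> {(x, y, z). x = s * y + c * z}) + 1 \<le> q * q"
proof -
  define X where "X = {y. (s * y + c, y) \<in> affine_part}"
  define Y where "Y = {k. (s + c * k, k) \<in> (J - {0}) \<times> (J - {0})}"
  have "1 \<noteq> s * r + c * j" if "j \<in> J" for r j
    using that rad_add[OF rad_mult_right[OF s] rad_mult_left] one_notin_rad by metis
  then have "arc_vectors \<inter> {(x, y, z). x = s * y + c * z}
      \<subseteq> (\<lambda>y. (s * y + c, y, 1)) ` X \<union> (\<lambda>k. (s + c * k, 1, k)) ` Y"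
    unfolding arc_vectors_def X_def Y_def infinite_part_def by auto
  then have bound: "card (arc_vectors \<inter> {(x, y, z). x = s * y + c * z}) \<le> card X + card Y"
    by (rule card_two_images)
  have "Y \<subseteq> J - {0}" unfolding Y_def by auto
  then have cardY: "card Y + 1 \<le> q" using card_mono[of "J - {0}" Y] card_rad_minus[of 0] by simp
  have u: "card (- J) + q = q * q" using card_compl_q[of J] by simp
  show ?thesis
  proof (cases "c \<in> J")
    case False
    have unit: "1 - t * s \<notin> J" for t
      using rad_add[of "1 - t * s" "t * s"] rad_mult_left[OF s, of t] by auto
    have unit': "s * y + c \<notin> J" for y
      using rad_diff[of "s * y + c" "s * y"] rad_mult_right[OF s, of y] False by auto
    \<comment> \<open>\<open>g t\<close> solves \<open>y = t * (s * y + c)\<close>, so it is the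
      second coordinate where the line meets y = t x.\<close>
    define g where "g t = uinv (1 - t * s) * (t * c)" for t
    have g: "g t = t * (s * g t + c)" for t
    proof -
      have "(1 - t * s) * g t = t * c" unfolding g_def using unit by simp
      then show ?thesis by (simp add: left_diff_distrib distrib_left mult.assoc algebra_simps)
    qed
    have "inj_on g T"
    proof (rule inj_onI)
      fix a b assume "g a = g b"
      then have "a * (s * g a + c) = b * (s * g a + c)" using g[of a] g[of b] by simp
      then show "a = b" using unit' unit_cancel_right by blast
    qed
    then have "card (g ` T) = q" using card_T by (simp add: card_image)
    moreover have "X \<subseteq> - (g ` T)"
    proof
      fix y assume "y \<in> X"
      then have "\<forall>t\<in>T. y \<noteq> t * (s * y + c)" unfolding X_def affine_part_def using unit'[of y] by auto
      then show "y \<in> - (g ` T)" using g by blast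
    qed
    then have "card X \<le> card (- (g ` T))" by (intro card_mono) auto
    ultimately show ?thesis using bound cardY card_compl_q[of "g ` T"] by linarith
  next
    case c: True
    have x: "s * y + c \<in> J" for y using rad_add rad_mult_right[OF s] c by blast
    \<comment> \<open>For \<open>y\<close> in \<open>J\<close> the product \<open>s * y\<close>
      vanishes, so the first entry is \<open>c\<close>, and the class of (0,0,1) keeps only points
      with first entry 0.\<close>
    have X: "X \<subseteq> {y. y \<notin> J \<and> s * y + c \<noteq> \<theta>} \<union> {y \<in> J - {0}. c = 0}"
      unfolding X_def affine_part_def using x s by auto
    show ?thesis
    proof (cases "s = 0")
      case True
      \<comment> \<open>Here \<open>s + c * k = 0\<close>: the line meets the class U in its second
        removed segment.\<close>
      then have "Y = {}" unfolding Y_def using c by auto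
      moreover have "X \<subseteq> - {0}" using X by auto
      then have "card X \<le> card (- {0 :: 'a})" by (intro card_mono) auto
      ultimately show ?thesis using bound card_compl_q[of "{0}"] by simp
    next
      case s0: False
      show ?thesis
      proof (cases "c = 0")
        case True
        \<comment> \<open>All \<open>q - 1\<close> kept points near (0,0,1) lie on this line. Since
          \<theta> is nonzero, its \<open>q\<close> common points with x = \<theta> z have unit
          \<open>y\<close> and outweigh them.\<close>
        define Z where "Z = {y. s * y = \<theta>}"
        have "card Z = q" unfolding Z_def using card_fibre_q s s0 \<theta> by blast
        moreover have "0 \<notin> Z" unfolding Z_def using \<theta> by auto
        ultimately have "card (insert 0 Z) = q + 1" by simp
        moreover have "X \<subseteq> - insert 0 Z" using X True s \<theta> unfolding Z_def by auto
        then have "card X \<le> card (- insert 0 Z)" by (intro card_mono) auto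
        ultimately show ?thesis using bound cardY card_compl_q[of "insert 0 Z"] by linarith
      next
        case False
        then have "X \<subseteq> - J" using X by auto
        then have "card X \<le> card (- J)" by (intro card_mono) auto
        then show ?thesis using bound cardY u by linarith
      qed
    qed
  qed
qed

text \<open>These are the neighbours of \<Lambda>, so all their points lie in classes on z = 0. On
  vectors (j, 1, k) the term \<open>\<alpha> * j\<close> vanishes, which forces
  \<open>k = \<beta>\<close>.\<close>

lemma count_line_third:
  assumes ab: "\<alpha> \<in> J" "\<beta> \<in> J"
  shows "card (arc_vectors \<inter> {(x, y, z). z = \<alpha> * x + \<beta> * y}) + 1 \<le> q * q"
proof -
  define X where "X = {s. (s, \<alpha> + \<beta> * s) \<in> infinite_part}"
  define Y where "Y = {j. (j, \<beta>) \<in> (J - {0}) \<times> (J - {0})}"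
  have "1 \<noteq> \<alpha> * x + \<beta> * y" for x y
    using rad_add[OF rad_mult_right[OF ab(1)] rad_mult_right[OF ab(2)]] one_notin_rad by metis
  then have "arc_vectors \<inter> {(x, y, z). z = \<alpha> * x + \<beta> * y}
      \<subseteq> (\<lambda>s. (1, s, \<alpha> + \<beta> * s)) ` X \<union> (\<lambda>j. (j, 1, \<beta>)) ` Y"
    unfolding arc_vectors_def X_def Y_def using ab by auto
  then have bound: "card (arc_vectors \<inter> {(x, y, z). z = \<alpha> * x + \<beta> * y}) \<le> card X + card Y"
    by (rule card_two_images)
  have "Y \<subseteq> J - {0}" unfolding Y_def by auto
  then have cardY: "card Y + 1 \<le> q" using card_mono[of "J - {0}" Y] card_rad_minus[of 0] by simp
  show ?thesis
  proof (cases "\<beta> = 0")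
    case True
    then have Y: "Y = {}" unfolding Y_def by auto
    \<comment> \<open>With \<open>Y\<close> empty, one missing parameter is enough: for \<alpha> = 0
      all points lie on \<Lambda>, otherwise surjectivity of \<phi> supplies an additional point of
      the complement.\<close>
    have "\<exists>s. s \<notin> X"
    proof (cases "\<alpha> = 0")
      case False
      then obtain s where "s \<in> T" "\<phi> s = \<alpha>" using \<phi>_onto ab by (metis Diff_iff imageE singletonD)
      then show ?thesis unfolding X_def infinite_part_def using True by auto
    qed (auto simp: X_def infinite_part_def True)
    then obtain s where "X \<subseteq> - {s}" by blast
    then have "card X \<le> card (- {s})" by (intro card_mono) auto
    then show ?thesis using bound Y card_compl_q[of "{s}"] by simp
  next
    case False
    \<comment> \<open>For nonzero \<beta> the line meets \<Lambda> in the \<open>q\<close> points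
      with these parameters.\<close>
    define Z where "Z = {s. \<beta> * s = - \<alpha>}"
    have "card Z = q" unfolding Z_def using card_fibre_q ab False rad_uminus by blast
    moreover have "X \<subseteq> - Z" unfolding X_def infinite_part_def Z_def by auto
    then have "card X \<le> card (- Z)" by (intro card_mono) auto
    ultimately show ?thesis using bound cardY card_compl_q[of Z] by linarith
  qed
qed

text \<open>Enlarging the line to the solution set of its equation can only increase the
  count.\<close>

lemma count_line:
  assumes "hline L" shows "card (arc_vectors \<inter> L) \<le> q ^ 2 - 1"
proof -
  have mono: "card (arc_vectors \<inter> L) + 1 \<le> q * q"
    if "L \<subseteq> M" "card (arc_vectors \<inter> M) + 1 \<le> q * q" for M
    using that card_mono[of "arc_vectors \<inter> M" "arc_vectors \<inter> L"] by fastforce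
  from assms have "card (arc_vectors \<inter> L) + 1 \<le> q * q"
    by (rule hline_equation) (metis mono count_line_first count_line_second count_line_third)+
  then show ?thesis by (simp add: power2_eq_square)
qed

section \<open>From generating vectors to points\<close>

definition pt :: "'a vec3 \<Rightarrow> 'a vec3 set" where "pt v = {vsmult v r | r. True}"

lemma arc_vectors_cases:
  assumes "v \<in> arc_vectors"
  obtains x y where "v = (x, y, 1)" | s j where "v = (1, s, j)" "j \<in> J"
  | j k where "v = (j, 1, k)" "j \<in> J" "k \<in> J"
  using assms unfolding arc_vectors_def infinite_part_def by auto

lemma hpoint_pt: "v \<in> arc_vectors \<Longrightarrow> hpoint (pt v)"
  unfolding hpoint_def pt_def
  by (rule exI[of _ v], erule arc_vectors_cases) (auto simp: inj_def vsmult_def)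

lemma mem_pt: "v \<in> pt v"
  unfolding pt_def by (rule CollectI, rule exI[of _ 1]) (simp add: vsmult_def)

text \<open>Each generator is normalised by an entry 1. Vectors of equal shape are related by the
  scalar 1; for different shapes some radical entry times a scalar would equal 1.\<close>

lemma inj_on_pt: "inj_on pt arc_vectors"
proof (rule inj_onI)
  fix v w assume v: "v \<in> arc_vectors" and w: "w \<in> arc_vectors" and eq: "pt v = pt w"
  have "w \<in> pt v" "v \<in> pt w" using mem_pt[of v] mem_pt[of w] eq by simp_all
  then obtain r s where r: "w = vsmult v r" and s: "v = vsmult w s" unfolding pt_def by blast
  have no: "j \<in> J \<Longrightarrow> j * a \<noteq> 1" "j \<in> J \<Longrightarrow> a * j \<noteq> 1" for j a
    using rad_mult_left rad_mult_right one_notin_rad by metis+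
  show "v = w"
    using v
  proof (cases rule: arc_vectors_cases)
    case (1 x y)
    with w r s show ?thesis by (cases rule: arc_vectors_cases) (auto simp: vsmult_def no)
  next
    case (2 x y)
    with w r s show ?thesis by (cases rule: arc_vectors_cases) (auto simp: vsmult_def no)
  next
    case (3 x y)
    with w r s show ?thesis by (cases rule: arc_vectors_cases) (auto simp: vsmult_def no)
  qed
qed

lemma proj_arc_arc_vectors: "proj_arc (pt ` arc_vectors) (q ^ 4 - q ^ 2 - q) (q ^ 2 - 1)"
  unfolding proj_arc_def
proof (intro conjI allI impI ballI)
  show "hpoint P" if "P \<in> pt ` arc_vectors" for P using that hpoint_pt by blast
  show "card (pt ` arc_vectors) = q ^ 4 - q ^ 2 - q"
    using card_image[OF inj_on_pt] card_arc_vectors by linarith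
  fix L :: "'a vec3 set" assume L: "hline L"
  \<comment> \<open>A point contained in the line has its generator on the line.\<close>
  have "{P \<in> pt ` arc_vectors. P \<subseteq> L} \<subseteq> pt ` (arc_vectors \<inter> L)" using mem_pt by blast
  then have "card {P \<in> pt ` arc_vectors. P \<subseteq> L} \<le> card (arc_vectors \<inter> L)"
    by (rule surj_card_le[rotated]) simp
  then show "card {P \<in> pt ` arc_vectors. P \<subseteq> L} \<le> q ^ 2 - 1" using count_line[OF L] by linarith
qed simp

end

section \<open>Choice of the parameters\<close>

theorem theorem3p1:
  fixes q :: nat
  assumes "chain_ring2 TYPE('a::ring_1)"
    and "residue_card TYPE('a) = q"
  shows "\<exists>K :: 'a vec3 set set. proj_arc K (q^4 - q^2 - q) (q^2 - 1)"
proof -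
  interpret length2_chain_ring "TYPE('a)" by unfold_locales (rule assms)
  obtain T :: "'a set" where T: "\<And>x. \<exists>t\<in>T. x - t \<in> rad"
      "\<And>s t. s \<in> T \<Longrightarrow> t \<in> T \<Longrightarrow> s - t \<in> rad \<Longrightarrow> s = t" and cT: "card T = residue_card TYPE('a)"
    by (rule transversal_exists) blast
  have q: "card (rad :: 'a set) = q" using card_transversal[OF T] cT assms by simp
  obtain \<theta> :: 'a where \<theta>: "\<theta> \<in> rad" "\<theta> \<noteq> 0" using rad_neq rad_0 by blast
  \<comment> \<open>There are \<open>q - 1\<close> nonzero radical elements and \<open>q\<close>
    representatives, so the former inject into \<open>T\<close>.\<close>
  have "card (rad - {0 :: 'a}) \<le> card T" using cT q assms by simp
  then obtain f where f: "f ` (rad - {0 :: 'a}) \<subseteq> T" "inj_on f (rad - {0})"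
    using card_le_inj[of "rad - {0 :: 'a}" T] by auto
  \<comment> \<open>A left inverse of the injection \<open>f\<close>; the default \<theta> keeps the
    remaining values nonzero and in the radical.\<close>
  define \<phi> where "\<phi> t = (if t \<in> f ` (rad - {0}) then inv_into (rad - {0}) f t else \<theta>)" for t
  have "\<phi> ` T = rad - {0}"
  proof (intro equalityI subsetI)
    fix j assume "j \<in> \<phi> ` T"
    then show "j \<in> rad - {0}" using \<theta> inv_into_into[of _ f "rad - {0}"] unfolding \<phi>_def by auto
  next
    fix j :: 'a assume j: "j \<in> rad - {0}"
    then have "\<phi> (f j) = j" unfolding \<phi>_def using f(2) by simp
    then show "j \<in> \<phi> ` T" using f(1) j by force
  qed
  then interpret arc_construction "TYPE('a)" q T \<phi> \<theta>
    using q T \<theta> by unfold_locales auto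
  show ?thesis using proj_arc_arc_vectors by blast
qed

end
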